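(* Let $d\ge 5$ be a prime number. The number of non-equivalent actions of the representations $M_a$, $2\le a\le d-1$, of $\mathbb{Z}/d\mathbb{Z}$ on $K[x,y,z]_d$ is equal to $n$ if $d=6n-1$, and to $n+1$ if $d=6n+1$.
   Context: $K$ is an algebraically closed field of characteristic zero, and $K[x,y,z]_d$ is the space of forms of degree $d$. Let $e\in K$ be a primitive $d$-th root of $1$. For an integer $a$, $M_a=\begin{pmatrix}1&0&0\\0&e&0\\0&0&e^a\end{pmatrix}$ acts by $x\mapsto x$, $y\mapsto ey$, $z\mapsto e^a z$. The actions of two matrices $M_a$ and $M_b$ on $K[x,y,z]_d$ are called equivalent if the homogeneous artinian ideals generated by all forms of degree $d$ invariant under $M_a$, respectively $M_b$, coincide up to a permutation of the variables $x,y,z$. *)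

theory Defs
  imports "HOL-Analysis.Cartesian_Space" "HOL-Library.Poly_Mapping"
    "HOL-Computational_Algebra.Polynomial" "HOL-Computational_Algebra.Primes"
begin

text \<open>
  The ring \<open>K[x,y,z]\<close> is the monoid ring of finitely supported functions from exponent vectors to
  \<open>K\<close>, with the convolution product. The variables \<open>x, y, z\<close> are indexed by \<open>1, 2, 3\<close> of type \<open>3\<close>.
\<close>

type_synonym 'a poly3 = "(3 \<Rightarrow>\<^sub>0 nat) \<Rightarrow>\<^sub>0 'a"

definition const :: "'a::comm_ring_1 \<Rightarrow> 'a poly3"
  where "const c = Poly_Mapping.single 0 c"

definition var :: "3 \<Rightarrow> 'a::comm_ring_1 poly3"
  where "var i = Poly_Mapping.single (Poly_Mapping.single i 1) 1"

text \<open>The \<open>K\<close>-algebra endomorphism sending each variable \<open>var i\<close> to \<open>f i\<close>.\<close>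

definition subst_vars :: "(3 \<Rightarrow> 'a poly3) \<Rightarrow> 'a poly3 \<Rightarrow> 'a::comm_ring_1 poly3"
  where "subst_vars f p =
    (\<Sum>m\<in>Poly_Mapping.keys p.
       const (Poly_Mapping.lookup p m) * (\<Prod>i\<in>UNIV. f i ^ Poly_Mapping.lookup m i))"

text \<open>\<open>forms d\<close> is \<open>K[x,y,z]\<^sub>d\<close>, including the zero polynomial.\<close>

definition forms :: "nat \<Rightarrow> 'a::comm_ring_1 poly3 set"
  where "forms d = {p. \<forall>m\<in>Poly_Mapping.keys p. (\<Sum>i\<in>UNIV. Poly_Mapping.lookup m i) = d}"

definition matrix_act :: "'a^3^3 \<Rightarrow> 'a poly3 \<Rightarrow> 'a::comm_ring_1 poly3"
  where "matrix_act A = subst_vars (\<lambda>i. \<Sum>j\<in>UNIV. const (A $ i $ j) * var j)"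

definition M :: "'a::field \<Rightarrow> int \<Rightarrow> 'a^3^3"
  where "M e a = vector [vector [1, 0, 0],
                         vector [0, e, 0],
                         vector [0, 0, e powi a]]"

text \<open>An ideal is a submodule of the ring regarded as a module over itself.\<close>

definition ideal_generated :: "'a::comm_ring_1 poly3 set \<Rightarrow> 'a poly3 set"
  where "ideal_generated = module.span (*)"

definition invariant_ideal :: "nat \<Rightarrow> 'a::field \<Rightarrow> int \<Rightarrow> 'a poly3 set"
  where "invariant_ideal d e a = ideal_generated {p \<in> forms d. matrix_act (M e a) p = p}"

definition permute_vars :: "(3 \<Rightarrow> 3) \<Rightarrow> 'a poly3 \<Rightarrow> 'a::comm_ring_1 poly3"
  where "permute_vars \<sigma> = subst_vars (\<lambda>i. var (\<sigma> i))"

definition equivalent_actions :: "nat \<Rightarrow> 'a::field \<Rightarrow> int \<Rightarrow> int \<Rightarrow> bool"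
  where "equivalent_actions d e a b \<longleftrightarrow>
    (\<exists>\<sigma>. bij \<sigma> \<and> permute_vars \<sigma> ` invariant_ideal d e a = invariant_ideal d e b)"

definition primitive_root_of_unity :: "nat \<Rightarrow> 'a::field \<Rightarrow> bool"
  where "primitive_root_of_unity d e \<longleftrightarrow> 0 < d \<and> e ^ d = 1 \<and> (\<forall>k. 0 < k \<and> k < d \<longrightarrow> e ^ k \<noteq> 1)"

text \<open>The number of classes of \<open>{2..d - 1}\<close> under equivalence of actions on forms of degree \<open>d\<close>.\<close>

definition num_nonequivalent_actions :: "nat \<Rightarrow> 'a::field \<Rightarrow> nat"
  where "num_nonequivalent_actions d e =
    card ({2..int d - 1} //
      {(a, b). a \<in> {2..int d - 1} \<and> b \<in> {2..int d - 1} \<and> equivalent_actions d e a b})"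

end

theory Submission
  imports Defs
begin

text \<open>
  The ideal of \<open>M\<^sub>a\<close> is the monomial ideal generated by the monomials \<open>x\<^bsup>i\<^esup> y\<^bsup>j\<^esup> z\<^bsup>k\<^esup>\<close> of
  degree \<open>d\<close> with \<open>j + a k \<equiv> 0\<close> modulo \<open>d\<close>. In degree \<open>d\<close> this set of exponents depends on the
  weights \<open>(0, 1, a)\<close> only up to affine maps of \<open>\<int>/d\<close>, and it determines them up to such maps. Permuting
  the variables therefore moves \<open>a\<close> within \<open>{a, 1/a, 1 - a, 1/(1 - a), 1 - 1/a, a/(a - 1)}\<close>, its
  orbit under the action of \<open>S\<^sub>3\<close> generated by \<open>a \<mapsto> 1 - a\<close> and \<open>a \<mapsto> 1/a\<close>. All orbits have six
  elements, except \<open>{2, 1/2, -1}\<close> and the roots of \<open>a\<^sup>2 - a + 1\<close>, which form at most one orbit. With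
  \<open>N\<close> orbits and \<open>k \<le> 1\<close> orbits of roots, \<open>(d - 2) + 3 + 4 k = 6 N\<close>, so that \<open>d\<close> modulo \<open>6\<close> forces
  \<open>k\<close>.
\<close>


section \<open>Substitutions that send monomials to monomials\<close>

text \<open>This is the exponent vector of a monomial after variable \<open>i\<close> becomes
  variable \<open>\<sigma> i\<close>. The sum is the form in which the product in
  \<open>subst_vars\<close> delivers it, for any \<sigma>.\<close>

definition relabel :: "('i::finite \<Rightarrow> 'i) \<Rightarrow> ('i \<Rightarrow>\<^sub>0 nat) \<Rightarrow> ('i \<Rightarrow>\<^sub>0 nat)"
  where "relabel \<sigma> m = (\<Sum>i\<in>UNIV. Poly_Mapping.single (\<sigma> i) (Poly_Mapping.lookup m i))"

lemma lookup_relabel: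
  assumes "bij \<sigma>"
  shows "Poly_Mapping.lookup (relabel \<sigma> m) i = Poly_Mapping.lookup m (inv \<sigma> i)"
proof -
  have "\<sigma> j = i \<longleftrightarrow> j = inv \<sigma> i" for j
    using assms by (metis bij_inv_eq_iff)
  then show ?thesis
    by (simp add: relabel_def lookup_sum lookup_single when_def)
qed

lemma relabel_id [simp]: "relabel (\<lambda>i. i) m = m"
  using lookup_relabel[OF bij_id] by (intro poly_mapping_eqI) (simp add: inv_id flip: id_def)

lemma relabel_inv:
  assumes "bij \<sigma>"
  shows "relabel \<sigma> (relabel (inv \<sigma>) m) = m" "relabel (inv \<sigma>) (relabel \<sigma> m) = m"
  using assms
  by (auto intro!: poly_mapping_eqI
      simp: lookup_relabel bij_imp_bij_inv inv_inv_eq bij_is_inj bij_is_surj surj_f_inv_f)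

lemma prod_single:
  fixes g :: "'i \<Rightarrow> 'a::comm_semiring_1"
  shows "(\<Prod>i\<in>I. Poly_Mapping.single (f i :: 'm::comm_monoid_add) (g i)) =
    Poly_Mapping.single (\<Sum>i\<in>I. f i) (\<Prod>i\<in>I. g i)"
  by (induction I rule: infinite_finite_induct) (simp_all add: mult_single)

lemma single_power:
  fixes c :: "'a::comm_semiring_1"
  shows "Poly_Mapping.single (Poly_Mapping.single i (1::nat)) c ^ n =
    Poly_Mapping.single (Poly_Mapping.single i n) (c ^ n)"
proof (induction n)
  case (Suc n)
  then show ?case
    by (simp only: power_Suc mult_single single_add[symmetric] plus_1_eq_Suc)
qed simp

lemma subst_vars_monomials:
  "subst_vars (\<lambda>i. Poly_Mapping.single (Poly_Mapping.single (\<sigma> i) 1) (c i)) p =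
    (\<Sum>m\<in>Poly_Mapping.keys p. Poly_Mapping.single (relabel \<sigma> m)
      (Poly_Mapping.lookup p m * (\<Prod>i\<in>UNIV. c i ^ Poly_Mapping.lookup m i)))"
  unfolding subst_vars_def const_def
  by (simp only: single_power prod_single mult_single relabel_def add_0_left)

text \<open>A bijective \<sigma> makes \<open>relabel \<sigma>\<close> injective, so distinct terms
  never merge. Taking all \<open>c i\<close> equal to 1 gives the permutations of variables, and
  taking \<sigma> to be the identity gives the diagonal matrices.\<close>

lemma lookup_subst_vars_monomials:
  assumes "bij \<sigma>"
  shows "Poly_Mapping.lookup
      (subst_vars (\<lambda>i. Poly_Mapping.single (Poly_Mapping.single (\<sigma> i) 1) (c i)) p) (relabel \<sigma> k) =
    Poly_Mapping.lookup p k * (\<Prod>i\<in>UNIV. c i ^ Poly_Mapping.lookup k i)"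
proof -
  have eq: "relabel \<sigma> m = relabel \<sigma> k \<longleftrightarrow> m = k" for m
    using relabel_inv(2)[OF assms] by metis
  show ?thesis
    by (simp only: subst_vars_monomials lookup_sum lookup_single eq)
      (simp add: when_def in_keys_iff)
qed

lemma lookup_permute_vars:
  assumes "bij \<sigma>"
  shows "Poly_Mapping.lookup (permute_vars \<sigma> p) (relabel \<sigma> k) = Poly_Mapping.lookup p k"
  using lookup_subst_vars_monomials[OF assms, where c = "\<lambda>_. 1"]
  by (simp add: permute_vars_def var_def)

text \<open>Permuting by \<open>inv \<sigma>\<close> supplies preimages. For spaces cut out by a
  support condition, only the set of exponents has to be moved.\<close>

lemma permute_vars_image:
  assumes "bij \<sigma>"
  shows "permute_vars \<sigma> ` {p. Poly_Mapping.keys p \<subseteq> U} = {p. Poly_Mapping.keys p \<subseteq> relabel \<sigma> ` U}"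
    (is "?L = ?R")
proof
  show "?L \<subseteq> ?R"
  proof clarify
    fix p m
    assume p: "Poly_Mapping.keys p \<subseteq> U" and m: "m \<in> Poly_Mapping.keys (permute_vars \<sigma> p)"
    have "relabel (inv \<sigma>) m \<in> Poly_Mapping.keys p"
      using m lookup_permute_vars[OF assms, of p "relabel (inv \<sigma>) m"]
      by (simp add: relabel_inv[OF assms] in_keys_iff)
    then show "m \<in> relabel \<sigma> ` U"
      using p relabel_inv(1)[OF assms, of m] by (metis image_eqI subsetD)
  qed
  show "?R \<subseteq> ?L"
  proof clarify
    fix q :: "'a poly3"
    assume q: "Poly_Mapping.keys q \<subseteq> relabel \<sigma> ` U"
    let ?p = "permute_vars (inv \<sigma>) q"
    have lookup_p: "Poly_Mapping.lookup ?p m = Poly_Mapping.lookup q (relabel \<sigma> m)" for m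
      using lookup_permute_vars[OF bij_imp_bij_inv[OF assms], of q "relabel \<sigma> m"]
      by (simp add: relabel_inv[OF assms])
    have "Poly_Mapping.lookup (permute_vars \<sigma> ?p) m = Poly_Mapping.lookup q m" for m
      using lookup_permute_vars[OF assms, of ?p "relabel (inv \<sigma>) m"]
      by (simp add: lookup_p relabel_inv[OF assms])
    then have "q = permute_vars \<sigma> ?p"
      by (intro poly_mapping_eqI) simp
    moreover have "Poly_Mapping.keys ?p \<subseteq> U"
    proof
      fix m assume "m \<in> Poly_Mapping.keys ?p"
      then have "relabel \<sigma> m \<in> relabel \<sigma> ` U"
        using q by (auto simp: in_keys_iff lookup_p)
      then show "m \<in> U"
        using relabel_inv(2)[OF assms] by (metis imageE)
    qed
    ultimately show "q \<in> ?L" by blast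
  qed
qed

section \<open>Monomial ideals\<close>

lemma sum_single_lookup:
  "(\<Sum>m\<in>Poly_Mapping.keys p. Poly_Mapping.single m (Poly_Mapping.lookup p m)) = p"
  by (rule poly_mapping_eqI) (simp add: lookup_sum lookup_single when_def in_keys_iff)

text \<open>The right side contains the generators (take \<open>r = 0\<close>) and is an ideal. It
  is the least one because each term of its members is a multiple of a monomial with exponent in
  \<open>S\<close>.\<close>

lemma ideal_generated_keys_subset:
  "ideal_generated {p :: 'a::comm_ring_1 poly3. Poly_Mapping.keys p \<subseteq> S} =
    {p. Poly_Mapping.keys p \<subseteq> {r + s |r s. s \<in> S}}" (is "_ = ?I")
proof -
  interpret module "(*) :: 'a poly3 \<Rightarrow> 'a poly3 \<Rightarrow> 'a poly3"
    by unfold_locales (simp_all add: algebra_simps)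
  have "span {p :: 'a poly3. Poly_Mapping.keys p \<subseteq> S} = ?I"
  proof (rule span_unique)
    show "{p. Poly_Mapping.keys p \<subseteq> S} \<subseteq> ?I"
      by clarify (metis add_0 subsetD)
    show "subspace ?I"
    proof (rule subspaceI)
      fix p q :: "'a poly3"
      assume "p \<in> ?I" "q \<in> ?I"
      then show "p + q \<in> ?I"
        using Poly_Mapping.keys_add[of p q] by blast
    next
      fix c p :: "'a poly3"
      assume p: "p \<in> ?I"
      show "c * p \<in> ?I"
      proof clarify
        fix m assume "m \<in> Poly_Mapping.keys (c * p)"
        then obtain k l where "m = k + l" "l \<in> Poly_Mapping.keys p"
          using keys_mult[of c p] by blast
        with p obtain r s where "m = k + (r + s)" "s \<in> S" by blast
        then show "\<exists>r s. m = r + s \<and> s \<in> S" by (metis add.assoc)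
      qed
    qed simp
  next
    fix T :: "'a poly3 set"
    assume T: "{p. Poly_Mapping.keys p \<subseteq> S} \<subseteq> T" "subspace T"
    show "?I \<subseteq> T"
    proof
      fix p assume p: "p \<in> ?I"
      have "Poly_Mapping.single m (Poly_Mapping.lookup p m) \<in> T" if m: "m \<in> Poly_Mapping.keys p" for m
      proof -
        obtain r s where rs: "m = r + s" "s \<in> S"
          using p m by blast
        then have "Poly_Mapping.single s 1 \<in> T"
          using T(1) by auto
        then have "Poly_Mapping.single r (Poly_Mapping.lookup p m) * Poly_Mapping.single s 1 \<in> T"
          by (rule subspace_scale[OF T(2)])
        then show ?thesis by (simp add: mult_single rs)
      qed
      then have "(\<Sum>m\<in>Poly_Mapping.keys p. Poly_Mapping.single m (Poly_Mapping.lookup p m)) \<in> T"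
        by (intro subspace_sum[OF T(2)])
      then show "p \<in> T" by (simp add: sum_single_lookup)
    qed
  qed
  then show ?thesis by (simp add: ideal_generated_def)
qed

section \<open>Invariant forms of a diagonal matrix\<close>

lemma primitive_root_powi_eq_1_iff:
  assumes "primitive_root_of_unity d e"
  shows "e powi k = 1 \<longleftrightarrow> int d dvd k"
proof -
  have d: "0 < d" "e ^ d = 1" "\<And>k. 0 < k \<Longrightarrow> k < d \<Longrightarrow> e ^ k \<noteq> 1"
    using assms by (auto simp: primitive_root_of_unity_def)
  have "e \<noteq> 0" using d(1,2) by (metis zero_power zero_neq_one)
  \<comment> \<open>Reducing \<open>k\<close> modulo \<open>d\<close> moves it into the range where
    primitivity speaks directly.\<close>
  have "e powi k = e powi (int d * (k div int d) + k mod int d)" by simp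
  also have "\<dots> = e powi (k mod int d)"
    using \<open>e \<noteq> 0\<close> d(2) by (subst power_int_add) (simp_all add: power_int_mult)
  also have "\<dots> = e ^ nat (k mod int d)"
    using d(1) by (simp add: power_int_def)
  finally have eq: "e powi k = e ^ nat (k mod int d)" .
  have "k mod int d < int d" "0 \<le> k mod int d" using d(1) by simp_all
  then have "e ^ nat (k mod int d) = 1 \<longleftrightarrow> k mod int d = 0"
    using d(3)[of "nat (k mod int d)"] by (cases "k mod int d = 0") auto
  then show ?thesis by (simp add: eq dvd_eq_mod_eq_0)
qed

text \<open>General weights are allowed because permuting the variables leaves the normal form
  \<open>(0, 1, a)\<close>.\<close>

definition invariant_exponents :: "nat \<Rightarrow> (3 \<Rightarrow> int) \<Rightarrow> (3 \<Rightarrow>\<^sub>0 nat) set"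
  where "invariant_exponents d w = {m. (\<Sum>i\<in>UNIV. Poly_Mapping.lookup m i) = d \<and>
    int d dvd (\<Sum>i\<in>UNIV. w i * int (Poly_Mapping.lookup m i))}"

definition weights :: "int \<Rightarrow> 3 \<Rightarrow> int"
  where "weights a i = (if i = 1 then 0 else if i = 2 then 1 else a)"

lemma weights_simps [simp]: "weights a 1 = 0" "weights a 2 = 1" "weights a 3 = a"
  by (simp_all add: weights_def)

lemma M_row:
  "(\<Sum>j\<in>UNIV. const (M e a $ i $ j) * var j) =
    Poly_Mapping.single (Poly_Mapping.single i 1) (e powi weights a i)"
  using exhaust_3[of i]
  by (auto simp: sum_3 M_def const_def var_def mult_single)

lemma prod_power_int:
  fixes x :: "'a::field"
  assumes "x \<noteq> 0"
  shows "(\<Prod>i\<in>I. x powi f i) = x powi (\<Sum>i\<in>I. f i)"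
  using assms by (induction I rule: infinite_finite_induct) (simp_all add: power_int_add)

text \<open>Monomials are eigenvectors, with eigenvalue \<open>e\<close> to the weighted degree.
  Hence a form is invariant exactly when each of its monomials is.\<close>

lemma lookup_matrix_act_M:
  assumes "e \<noteq> 0"
  shows "Poly_Mapping.lookup (matrix_act (M e a) p) m = Poly_Mapping.lookup p m *
    e powi (\<Sum>i\<in>UNIV. weights a i * int (Poly_Mapping.lookup m i))"
  using lookup_subst_vars_monomials[OF bij_id, of "\<lambda>i. e powi weights a i" p m]
  by (simp add: matrix_act_def M_row prod_power_int[OF assms] power_int_power' id_def)

lemma invariant_forms_M:
  assumes "primitive_root_of_unity d e"
  shows "{p \<in> forms d. matrix_act (M e a) p = p} =
    {p. Poly_Mapping.keys p \<subseteq> invariant_exponents d (weights a)}"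
proof -
  have "0 < d" "e ^ d = 1"
    using assms by (auto simp: primitive_root_of_unity_def)
  then have "e \<noteq> 0" by (metis zero_power zero_neq_one)
  have "matrix_act (M e a) p = p \<longleftrightarrow> (\<forall>m\<in>Poly_Mapping.keys p.
      int d dvd (\<Sum>i\<in>UNIV. weights a i * int (Poly_Mapping.lookup m i)))" for p
    unfolding poly_mapping_eq_iff fun_eq_iff lookup_matrix_act_M[OF \<open>e \<noteq> 0\<close>]
      primitive_root_powi_eq_1_iff[OF assms, symmetric]
    by (auto simp: in_keys_iff)
  then show ?thesis
    by (auto simp: forms_def invariant_exponents_def)
qed

lemma invariant_ideal_eq:
  assumes "primitive_root_of_unity d e"
  shows "invariant_ideal d e a =
    {p. Poly_Mapping.keys p \<subseteq> {r + s |r s. s \<in> invariant_exponents d (weights a)}}"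
  by (simp add: invariant_ideal_def invariant_forms_M[OF assms] ideal_generated_keys_subset)


section \<open>From equality of ideals to congruences between weights\<close>

lemma sum_relabel:
  assumes "bij \<sigma>"
  shows "(\<Sum>i\<in>UNIV. f i (Poly_Mapping.lookup (relabel \<sigma> m) i)) =
    (\<Sum>i\<in>UNIV. f (\<sigma> i) (Poly_Mapping.lookup m i))"
  using sum.reindex_bij_betw[OF assms, of "\<lambda>i. f i (Poly_Mapping.lookup m (inv \<sigma> i))"] assms
  by (simp add: lookup_relabel bij_is_inj)

lemma relabel_add: "bij \<sigma> \<Longrightarrow> relabel \<sigma> (k + m) = relabel \<sigma> k + relabel \<sigma> m"
  by (rule poly_mapping_eqI) (simp add: lookup_relabel lookup_add)

lemma relabel_image_invariant_exponents:
  assumes "bij \<sigma>"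
  shows "relabel \<sigma> ` invariant_exponents d w = invariant_exponents d (w \<circ> inv \<sigma>)"
proof -
  have iff: "relabel \<sigma> m \<in> invariant_exponents d (w \<circ> inv \<sigma>) \<longleftrightarrow> m \<in> invariant_exponents d w" for m
    using sum_relabel[OF assms, of "\<lambda>_ k. k" m] assms
      sum_relabel[OF assms, of "\<lambda>i k. w (inv \<sigma> i) * int k" m]
    by (simp add: invariant_exponents_def bij_is_inj)
  show ?thesis
  proof (intro subset_antisym subsetI)
    fix m assume "m \<in> invariant_exponents d (w \<circ> inv \<sigma>)"
    then have "relabel (inv \<sigma>) m \<in> invariant_exponents d w"
      using iff[of "relabel (inv \<sigma>) m"] relabel_inv(1)[OF assms] by simp
    then show "m \<in> relabel \<sigma> ` invariant_exponents d w"
      using relabel_inv(1)[OF assms, of m] by (metis image_eqI)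
  qed (auto simp: iff)
qed

text \<open>All generating exponents have the same total degree \<open>d\<close>, so none is a
  proper multiple of another and the ideal remembers them.\<close>

lemma upward_closure_eq_iff:
  "{r + s |r s. s \<in> invariant_exponents d v} = {r + s |r s. s \<in> invariant_exponents d w} \<longleftrightarrow>
    invariant_exponents d v = invariant_exponents d w" (is "?up v = ?up w \<longleftrightarrow> _")
proof
  have "s \<in> invariant_exponents d v"
    if eq: "?up v = ?up w" and s: "s \<in> invariant_exponents d w" for v w s
  proof -
    have "s \<in> ?up w"
      using s by clarify (metis add_0)
    then obtain r t where rt: "s = r + t" "t \<in> invariant_exponents d v"
      using eq by blast
    have "(\<Sum>i\<in>UNIV. Poly_Mapping.lookup r i) = 0"
      using s rt by (simp add: invariant_exponents_def lookup_add sum.distrib)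
    then have "r = 0"
      by (intro poly_mapping_eqI) simp
    then show ?thesis using rt by simp
  qed
  moreover assume "?up v = ?up w"
  ultimately show "invariant_exponents d v = invariant_exponents d w" by blast
qed simp

lemma polys_on_eq_iff:
  "{p :: 'm \<Rightarrow>\<^sub>0 'a::zero_neq_one. Poly_Mapping.keys p \<subseteq> U} = {p. Poly_Mapping.keys p \<subseteq> V} \<longleftrightarrow> U = V"
proof
  assume eq: "{p :: 'm \<Rightarrow>\<^sub>0 'a. Poly_Mapping.keys p \<subseteq> U} = {p. Poly_Mapping.keys p \<subseteq> V}"
  have "m \<in> U \<longleftrightarrow> m \<in> V" for m
    using eq[THEN eqset_imp_iff, of "Poly_Mapping.single m 1"] by simp
  then show "U = V" by blast
qed simp

text \<open>Ideals are compared by supports, and supports by their generators in degree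
  \<open>d\<close>. Here \<tau> is the inverse of the permutation of the variables.\<close>

lemma equivalent_actions_iff_exponents:
  assumes "primitive_root_of_unity d e"
  shows "equivalent_actions d e a b \<longleftrightarrow>
    (\<exists>\<tau>. bij \<tau> \<and> invariant_exponents d (weights a \<circ> \<tau>) = invariant_exponents d (weights b))"
proof -
  let ?up = "\<lambda>w. {r + s |r s. s \<in> invariant_exponents d w}"
  have up: "relabel \<sigma> ` ?up w = ?up (w \<circ> inv \<sigma>)" if "bij \<sigma>" for \<sigma> w
  proof -
    have "relabel \<sigma> ` ?up w = {relabel \<sigma> r + s |r s. s \<in> relabel \<sigma> ` invariant_exponents d w}"
      by (auto simp: image_iff relabel_add[OF that]) (metis relabel_add[OF that])+
    \<comment> \<open>The cofactor \<open>r\<close> is arbitrary and \<open>relabel \<sigma>\<close>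
      is onto, so relabelling it changes nothing.\<close>
    also have "\<dots> = {r + s |r s. s \<in> relabel \<sigma> ` invariant_exponents d w}"
      using relabel_inv(1)[OF that] by (intro Collect_cong) metis
    finally show ?thesis
      by (simp add: relabel_image_invariant_exponents[OF that])
  qed
  have image: "permute_vars \<sigma> ` invariant_ideal d e a = invariant_ideal d e b \<longleftrightarrow>
      invariant_exponents d (weights a \<circ> inv \<sigma>) = invariant_exponents d (weights b)"
    if "bij \<sigma>" for \<sigma>
    unfolding invariant_ideal_eq[OF assms] permute_vars_image[OF that] up[OF that] polys_on_eq_iff
    by (rule upward_closure_eq_iff)
  show ?thesis
    unfolding equivalent_actions_def using image bij_imp_bij_inv inv_inv_eq by metis
qed

text \<open>The monomial \<open>x\<^bsup>b - 1\<^esup> y\<^bsup>d - b\<^esup> z\<close> is invariant for the weights \<open>0, 1, b\<close>,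
  and it recovers \<open>b\<close>.\<close>

lemma invariant_exponents_eq_weights_iff:
  fixes v :: "3 \<Rightarrow> int"
  assumes "prime d" and b: "2 \<le> b" "b \<le> int d - 1" and "\<not> int d dvd v 2 - v 1"
  shows "invariant_exponents d v = invariant_exponents d (weights b) \<longleftrightarrow>
    int d dvd v 3 - v 1 - b * (v 2 - v 1)" (is "?L \<longleftrightarrow> ?R")
proof
  assume ?L
  define m :: "3 \<Rightarrow>\<^sub>0 nat" where
    "m = Poly_Mapping.single 1 (nat (b - 1)) + Poly_Mapping.single 2 (nat (int d - b)) +
      Poly_Mapping.single 3 1"
  have m: "Poly_Mapping.lookup m 1 = nat (b - 1)" "Poly_Mapping.lookup m 2 = nat (int d - b)"
    "Poly_Mapping.lookup m 3 = 1"
    by (simp_all add: m_def lookup_add lookup_single)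
  have "m \<in> invariant_exponents d (weights b)"
    using b by (simp add: invariant_exponents_def sum_3 m)
  then have "m \<in> invariant_exponents d v" using \<open>?L\<close> by simp
  then have "int d dvd v 1 * (b - 1) + v 2 * (int d - b) + v 3"
    using b by (simp add: invariant_exponents_def sum_3 m)
  also have "v 1 * (b - 1) + v 2 * (int d - b) + v 3 =
      int d * v 2 + (v 3 - v 1 - b * (v 2 - v 1))"
    by (simp add: algebra_simps)
  finally show ?R by (simp add: dvd_add_right_iff)
next
  assume R: ?R
  have "int d dvd (\<Sum>i\<in>UNIV. v i * int (Poly_Mapping.lookup m i)) \<longleftrightarrow>
      int d dvd (\<Sum>i\<in>UNIV. weights b i * int (Poly_Mapping.lookup m i))"
    if "(\<Sum>i\<in>UNIV. Poly_Mapping.lookup m i) = d" for m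
  proof -
    define p q where "p = int (Poly_Mapping.lookup m 2)" and "q = int (Poly_Mapping.lookup m 3)"
    have first: "int (Poly_Mapping.lookup m 1) = int d - p - q"
      using that by (simp add: sum_3 p_def q_def)
    \<comment> \<open>Eliminating the exponent of the first variable leaves, modulo
      \<open>d\<close>, the weighted degree for \<open>(0, 1, b)\<close> times
      \<open>v 2 - v 1\<close>, which is invertible modulo the prime \<open>d\<close>.\<close>
    have "v 1 * (int d - p - q) + v 2 * p + v 3 * q =
        int d * v 1 + (v 3 - v 1 - b * (v 2 - v 1)) * q + (v 2 - v 1) * (p + b * q)"
      by (simp add: algebra_simps)
    moreover have "int d dvd int d * v 1 + (v 3 - v 1 - b * (v 2 - v 1)) * q"
      using R by (intro dvd_add) auto
    ultimately have "int d dvd v 1 * (int d - p - q) + v 2 * p + v 3 * q \<longleftrightarrow>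
        int d dvd (v 2 - v 1) * (p + b * q)"
      by (simp add: dvd_add_right_iff)
    also have "\<dots> \<longleftrightarrow> int d dvd p + b * q"
      using assms(1,4) by (simp add: prime_dvd_mult_iff)
    finally show ?thesis
      by (simp add: sum_3 first flip: p_def q_def)
  qed
  then show ?L by (auto simp: invariant_exponents_def)
qed

lemma bij_3_iff: "bij \<tau> \<longleftrightarrow> \<tau> 1 \<noteq> \<tau> 2 \<and> \<tau> 1 \<noteq> \<tau> 3 \<and> \<tau> 2 \<noteq> \<tau> (3::3)" for \<tau> :: "3 \<Rightarrow> 3"
proof -
  have "bij \<tau> \<longleftrightarrow> inj \<tau>"
    using finite_UNIV_inj_surj[of \<tau>] by (auto simp: bij_def)
  also have "\<dots> \<longleftrightarrow> \<tau> 1 \<noteq> \<tau> 2 \<and> \<tau> 1 \<noteq> \<tau> 3 \<and> \<tau> 2 \<noteq> \<tau> 3"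
    by (auto simp: inj_def forall_3)
  finally show ?thesis .
qed

lemma ex_bij_3_iff:
  "(\<exists>\<tau> :: 3 \<Rightarrow> 3. bij \<tau> \<and> P (\<tau> 1) (\<tau> 2) (\<tau> 3)) \<longleftrightarrow>
    P 1 2 3 \<or> P 1 3 2 \<or> P 2 1 3 \<or> P 2 3 1 \<or> P 3 1 2 \<or> P 3 2 1" (is "?L \<longleftrightarrow> ?R")
proof
  assume ?L
  then obtain \<tau> :: "3 \<Rightarrow> 3" where "bij \<tau>" "P (\<tau> 1) (\<tau> 2) (\<tau> 3)" by blast
  then show ?R
    using exhaust_3[of "\<tau> 1"] exhaust_3[of "\<tau> 2"] exhaust_3[of "\<tau> 3"]
    unfolding bij_3_iff by metis
next
  have "\<exists>\<tau> :: 3 \<Rightarrow> 3. bij \<tau> \<and> P (\<tau> 1) (\<tau> 2) (\<tau> 3)"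
    if "P x y z" "x \<noteq> y" "x \<noteq> z" "y \<noteq> z" for x y z
    using that
    by (intro exI[of _ "\<lambda>i. if i = 1 then x else if i = 2 then y else z"]) (simp add: bij_3_iff)
  moreover assume ?R
  ultimately show ?L
    by (elim disjE) auto
qed

text \<open>The affine map taking the first two permuted weights to 0 and 1 takes the third to
  \<open>b\<close>. With denominators cleared, the six cases read \<open>b = a\<close>,
  \<open>1/a\<close>, \<open>1 - a\<close>, \<open>1/(1 - a)\<close>, \<open>1 - 1/a\<close>,
  \<open>a/(a - 1)\<close>.\<close>

lemma equivalent_actions_iff:
  assumes "prime d" and "primitive_root_of_unity d e"
    and a: "2 \<le> a" "a \<le> int d - 1" and b: "2 \<le> b" "b \<le> int d - 1"
  shows "equivalent_actions d e a b \<longleftrightarrow>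
    int d dvd a - b \<or> int d dvd 1 - b * a \<or> int d dvd (a - 1) + b \<or>
    int d dvd 1 + b * (a - 1) \<or> int d dvd (1 - a) + b * a \<or> int d dvd a + b * (1 - a)"
proof -
  have small: "\<not> int d dvd k" if "\<bar>k\<bar> < int d" "k \<noteq> 0" for k
    using that dvd_imp_le_int[of k "int d"] by auto
  \<comment> \<open>The range of \<open>a\<close> keeps 0, 1 and \<open>a\<close> distinct modulo
    \<open>d\<close>.\<close>
  have ndvd: "\<not> int d dvd weights a x - weights a y" if "x \<noteq> y" for x y
    using a that exhaust_3[of x] exhaust_3[of y] by (intro small) auto
  define P where "P x y z \<longleftrightarrow>
    int d dvd weights a z - weights a x - b * (weights a y - weights a x)" for x y z
  have "invariant_exponents d (weights a \<circ> \<tau>) = invariant_exponents d (weights b) \<longleftrightarrow>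
      P (\<tau> 1) (\<tau> 2) (\<tau> 3)" if "bij \<tau>" for \<tau>
    using invariant_exponents_eq_weights_iff[OF assms(1) b, of "weights a \<circ> \<tau>"]
      ndvd[of "\<tau> 2" "\<tau> 1"] that
    by (auto simp: P_def bij_3_iff)
  then have "equivalent_actions d e a b \<longleftrightarrow> (\<exists>\<tau> :: 3 \<Rightarrow> 3. bij \<tau> \<and> P (\<tau> 1) (\<tau> 2) (\<tau> 3))"
    unfolding equivalent_actions_iff_exponents[OF assms(2)] by blast
  also have "\<dots> \<longleftrightarrow> P 1 2 3 \<or> P 1 3 2 \<or> P 2 1 3 \<or> P 2 3 1 \<or> P 3 1 2 \<or> P 3 2 1"
    by (rule ex_bij_3_iff)
  also have "P 1 2 3 \<longleftrightarrow> int d dvd a - b" by (simp add: P_def)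
  also have "P 1 3 2 \<longleftrightarrow> int d dvd 1 - b * a" by (simp add: P_def)
  also have "P 2 1 3 \<longleftrightarrow> int d dvd (a - 1) + b" by (simp add: P_def)
  also have "P 2 3 1 \<longleftrightarrow> int d dvd 1 + b * (a - 1)"
    using dvd_minus_iff[of "int d" "1 + b * (a - 1)"] by (simp add: P_def algebra_simps)
  also have "P 3 1 2 \<longleftrightarrow> int d dvd (1 - a) + b * a" by (simp add: P_def)
  also have "P 3 2 1 \<longleftrightarrow> int d dvd a + b * (1 - a)"
    using dvd_minus_iff[of "int d" "a + b * (1 - a)"] by (simp add: P_def algebra_simps)
  finally show ?thesis .
qed


section \<open>Orbits of \<open>S_3\<close> generated by two involutions\<close>

text \<open>Here \<open>s\<close> and \<open>t\<close> stand for \<open>a \<mapsto> 1 - a\<close> and \<open>a \<mapsto> 1/a\<close>, with fixed points \<open>h = 1/2\<close> and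
  \<open>m = -1\<close>; the solutions of \<open>s a = t a\<close> are the roots of \<open>a\<^sup>2 - a + 1\<close>.\<close>

locale anharmonic =
  fixes A :: "'b set" and s t :: "'b \<Rightarrow> 'b" and h m :: 'b
  assumes finite_A: "finite A"
    and s_in: "\<And>a. a \<in> A \<Longrightarrow> s a \<in> A" and t_in: "\<And>a. a \<in> A \<Longrightarrow> t a \<in> A"
    and ss: "\<And>a. a \<in> A \<Longrightarrow> s (s a) = a" and tt: "\<And>a. a \<in> A \<Longrightarrow> t (t a) = a"
    and braid: "\<And>a. a \<in> A \<Longrightarrow> s (t (s a)) = t (s (t a))"
    and h: "h \<in> A" "\<And>a. a \<in> A \<Longrightarrow> s a = a \<longleftrightarrow> a = h"
    and m: "m \<in> A" "\<And>a. a \<in> A \<Longrightarrow> t a = a \<longleftrightarrow> a = m"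
    and hm: "h \<noteq> m"
    and roots: "\<And>a b. a \<in> A \<Longrightarrow> b \<in> A \<Longrightarrow> s a = t a \<Longrightarrow> s b = t b \<Longrightarrow> b = a \<or> b = s a"
begin

text \<open>These are the reduced words of \<open>S_3\<close> in \<open>s\<close> and
  \<open>t\<close>. By \<open>braid\<close>, the longest one is also
  \<open>t (s (t a))\<close>.\<close>

definition orbit :: "'b \<Rightarrow> 'b set"
  where "orbit a = {a, s a, t a, s (t a), t (s a), s (t (s a))}"

lemma orbit_subset: "a \<in> A \<Longrightarrow> orbit a \<subseteq> A"
  by (simp add: orbit_def s_in t_in)

lemma orbit_s: "a \<in> A \<Longrightarrow> orbit (s a) = orbit a"
  using ss tt s_in t_in braid[of a] by (auto simp: orbit_def)

lemma orbit_t: "a \<in> A \<Longrightarrow> orbit (t a) = orbit a"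
  using ss tt s_in t_in braid[of a] braid[of "t a"] by (auto simp: orbit_def)

lemma orbit_eq:
  assumes "a \<in> A" "b \<in> orbit a"
  shows "orbit b = orbit a"
proof -
  have "b = a \<or> b = s a \<or> b = t a \<or> b = s (t a) \<or> b = t (s a) \<or> b = s (t (s a))"
    using assms(2) by (simp add: orbit_def)
  then show ?thesis
    using assms(1) by (elim disjE) (simp_all add: orbit_s orbit_t s_in t_in)
qed

text \<open>Since \<open>s\<close> fixes \<open>h\<close>, the braid relation makes
  \<open>s (t h)\<close> a fixed point of \<open>t\<close>, hence equal to \<open>m\<close>. So both
  fixed points share one orbit, the abstract form of \<open>{1/2, 2, -1}\<close>.\<close>

lemma card_orbit_h: "card (orbit h) = 3" "m \<in> orbit h"
proof -
  have "s h = h" using h by simp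
  have "t (s (t h)) = s (t h)" using braid[of h] h \<open>s h = h\<close> by simp
  then have "s (t h) = m" using m h s_in t_in by metis
  then have "orbit h = {h, t h, m}"
    using \<open>s h = h\<close> by (auto simp: orbit_def)
  moreover have "h \<noteq> t h" "t h \<noteq> m"
    using h m hm tt by metis+
  ultimately show "card (orbit h) = 3" "m \<in> orbit h"
    using hm by auto
qed

lemma orbit_root:
  assumes "a \<in> A" "s a = t a"
  shows "orbit a = {a, s a}"
proof -
  have "s (t a) = a" "t (s a) = a"
    using assms ss[of a] tt[of a] by simp_all
  then show ?thesis
    using assms(2) by (auto simp: orbit_def)
qed

text \<open>If \<open>s\<close> fixed \<open>a\<close>, then \<open>t\<close> would too, forcing
  \<open>h = m\<close>.\<close>

lemma card_orbit_root:
  assumes "a \<in> A" "s a = t a"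
  shows "card (orbit a) = 2"
proof -
  have "s a \<noteq> a" using assms h m hm by metis
  then show ?thesis by (simp add: orbit_root[OF assms])
qed

text \<open>Outside the orbit of \<open>h\<close> no member is fixed by \<open>s\<close> or
  \<open>t\<close>. Any coincidence of two words reduces, by cancelling involutions and
  \<open>braid\<close>, to such a fixed point or to \<open>s a = t a\<close>.\<close>

lemma card_orbit_generic:
  assumes a: "a \<in> A" and "a \<notin> orbit h" and root: "s a \<noteq> t a"
  shows "card (orbit a) = 6"
proof -
  have not_fixed: "s b \<noteq> b" "t b \<noteq> b" if "b \<in> orbit a" for b
  proof -
    have "b \<in> A" using that orbit_subset[OF a] by blast
    have "a \<in> orbit b" using orbit_eq[OF a that] by (simp add: orbit_def)
    have "b \<noteq> h" using \<open>a \<in> orbit b\<close> assms(2) by auto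
    moreover have "b \<noteq> m"
      using \<open>a \<in> orbit b\<close> assms(2) orbit_eq[OF h(1) card_orbit_h(2)] by auto
    ultimately show "s b \<noteq> b" "t b \<noteq> b"
      using h(2) m(2) \<open>b \<in> A\<close> by auto
  qed
  note A = a s_in t_in
  have 1: "s a \<noteq> a" "t a \<noteq> a" "s (t a) \<noteq> t a" "t (s a) \<noteq> s a"
    using not_fixed[of a] not_fixed[of "s a"] not_fixed[of "t a"] by (simp_all add: orbit_def)
  have 2: "s (t a) \<noteq> a" "t (s a) \<noteq> a"
    using root ss[of "t a"] tt[of "s a"] A by metis+
  have 3: "s (t (s a)) \<noteq> a" "s (t (s a)) \<noteq> s a" "s (t (s a)) \<noteq> t (s a)"
    using 1 2 ss tt A not_fixed(1)[of "t (s a)"] by (metis, metis, simp add: orbit_def)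
  have 4: "s (t a) \<noteq> s a" using 1 ss A by metis
  have 5: "t (s a) \<noteq> t a" using 1 tt A by metis
  have 6: "s (t (s a)) \<noteq> t a"
    using braid[OF a] 2 tt A 1 by metis
  have 7: "s (t (s a)) \<noteq> s (t a)" using 5 ss A by metis
  have 8: "t (s a) \<noteq> s (t a)"
  proof
    assume "t (s a) = s (t a)"
    then have "s (t (s a)) = t a" using ss A by simp
    with 6 show False by simp
  qed
  have "distinct [a, s a, t a, s (t a), t (s a), s (t (s a))]"
    using 1 2 3 4 5 6 7 8 root by auto
  then have "card (set [a, s a, t a, s (t a), t (s a), s (t (s a))]) = 6"
    by (simp only: distinct_card) simp
  then show ?thesis by (simp add: orbit_def)
qed

text \<open>Every orbit is padded to six elements: the orbit of \<open>h\<close> lacks 3 and an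
  orbit of roots lacks 4. The witness for \<open>k\<close> is the number of orbits of roots.\<close>

lemma card_orbits:
  "\<exists>k\<le>1. card A + 3 + 4 * k = 6 * card (A // {(a, b). a \<in> A \<and> b \<in> A \<and> b \<in> orbit a})"
proof -
  define Q where "Q = orbit ` A"
  define E where "E = orbit ` {a \<in> A. s a = t a}"
  have quotient: "A // {(a, b). a \<in> A \<and> b \<in> A \<and> b \<in> orbit a} = Q"
  proof -
    have "{(a, b). a \<in> A \<and> b \<in> A \<and> b \<in> orbit a} `` {a} = orbit a" if "a \<in> A" for a
      using that orbit_subset by auto
    then show ?thesis by (auto simp: quotient_def Q_def)
  qed
  have "finite Q" by (simp add: Q_def finite_A)
  have "orbit h \<in> Q" using h by (simp add: Q_def)
  have E: "E \<subseteq> Q" by (auto simp: E_def Q_def)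
  have "X = Y" if XY: "X \<in> E" "Y \<in> E" for X Y
  proof -
    obtain a b where ab: "a \<in> A" "s a = t a" "X = orbit a" "b \<in> A" "s b = t b" "Y = orbit b"
      using XY by (auto simp: E_def)
    then show ?thesis
      using roots[of a b] orbit_s by metis
  qed
  then have "card E \<le> 1"
    using finite_subset[OF E \<open>finite Q\<close>] by (simp add: card_le_Suc0_iff_eq)
  have a_in: "a \<in> orbit a" for a by (simp add: orbit_def)
  have "\<Union> Q = A"
    using orbit_subset a_in by (auto simp: Q_def)
  moreover have "pairwise disjnt Q"
    unfolding pairwise_def disjnt_iff Q_def using orbit_eq by (metis imageE)
  moreover have "finite X" if "X \<in> Q" for X
    using that by (auto simp: Q_def orbit_def)
  ultimately have "card A = (\<Sum>X\<in>Q. card X)"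
    using card_Union_disjoint[of Q] by metis
  moreover have "(\<Sum>X\<in>Q. card X + ((if X = orbit h then 3 else 0) + (if X \<in> E then 4 else 0))) =
      (\<Sum>X\<in>Q. 6)"
  proof (rule sum.cong[OF refl])
    fix X assume "X \<in> Q"
    then obtain a where a: "a \<in> A" "X = orbit a" by (auto simp: Q_def)
    \<comment> \<open>Besides giving the size, this separates \<open>E\<close> from the orbit of
      \<open>h\<close>, which has 3 elements, so no orbit is padded twice.\<close>
    have E2: "card Y = 2" if "Y \<in> E" for Y
      using that card_orbit_root by (auto simp: E_def)
    consider "a \<in> orbit h" | "s a = t a" | "a \<notin> orbit h" "s a \<noteq> t a" by blast
    then show "card X + ((if X = orbit h then 3 else 0) + (if X \<in> E then 4 else 0)) = 6"
    proof cases
      case 1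
      then have "X = orbit h" using a orbit_eq h by metis
      then show ?thesis using card_orbit_h(1) E2[of X] by auto
    next
      case 2
      then have "X \<in> E" using a by (auto simp: E_def)
      then show ?thesis using card_orbit_h(1) E2[of X] by auto
    next
      case 3
      then have "card X = 6" using a card_orbit_generic by simp
      then show ?thesis using card_orbit_h(1) E2[of X] by auto
    qed
  qed
  moreover have "(\<Sum>X\<in>Q. if X = orbit h then 3 else 0) = (3::nat)"
    using \<open>finite Q\<close> \<open>orbit h \<in> Q\<close> by simp
  moreover have "(\<Sum>X\<in>Q. if X \<in> E then 4 else 0) = 4 * card E"
    using \<open>finite Q\<close> E by (simp add: Int_absorb1 flip: sum.inter_restrict)
  ultimately have "card A + 3 + 4 * card E = 6 * card Q"
    by (simp add: sum.distrib)
  with \<open>card E \<le> 1\<close> show ?thesis unfolding quotient by blast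
qed

end

section \<open>The action on residues modulo \<open>d\<close>\<close>

text \<open>A Bezout coefficient of \<open>a\<close>, reduced modulo \<open>d\<close>, is an
  inverse. It is not 1 because \<open>a\<close> is not 1 modulo \<open>d\<close>.\<close>

lemma modular_inverse_exists:
  assumes "prime d" and a: "2 \<le> a" "a \<le> int d - 1"
  shows "\<exists>b\<in>{2..int d - 1}. int d dvd a * b - 1"
proof -
  have "\<not> int d dvd a"
    using a zdvd_not_zless[of a "int d"] by simp
  then have "gcd a (int d) = 1"
    using assms(1) prime_imp_coprime[of "int d" a] by (simp add: coprime_iff_gcd_eq_1 gcd.commute)
  then obtain u v where uv: "u * a + v * int d = 1"
    using bezout_int[of a "int d"] by metis
  define b where "b = u mod int d"
  have "d > 0" using assms(1) by (simp add: prime_gt_0_nat)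
  have "a * b - 1 = int d * (- v - a * (u div int d))"
    using uv by (simp add: b_def minus_div_mult_eq_mod[symmetric] algebra_simps)
  then have dvd: "int d dvd a * b - 1" by simp
  have "0 \<le> b" "b < int d" using \<open>d > 0\<close> by (simp_all add: b_def)
  moreover have "b \<noteq> 0"
    using dvd a by (auto dest: zdvd_imp_le)
  moreover have "b \<noteq> 1"
    using dvd a zdvd_not_zless[of "a - 1" "int d"] by auto
  ultimately show ?thesis using dvd by (intro bexI[of _ b]) auto
qed


text \<open>The orbit count applies to the representatives \<open>{2..d - 1}\<close> of the residues
  other than 0 and 1, on which the six divisibilities say that \<open>b\<close> lies in the orbit of
  \<open>a\<close>.\<close>

lemma card_anharmonic_classes:
  assumes "prime d" "d \<ge> 5"
  shows "\<exists>k\<le>1. int d + 1 + 4 * int k = 6 * int (card ({2..int d - 1} //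
    {(a, b). a \<in> {2..int d - 1} \<and> b \<in> {2..int d - 1} \<and>
      (int d dvd a - b \<or> int d dvd 1 - b * a \<or> int d dvd (a - 1) + b \<or>
       int d dvd 1 + b * (a - 1) \<or> int d dvd (1 - a) + b * a \<or> int d dvd a + b * (1 - a))}))"
    (is "\<exists>k\<le>1. _ = 6 * int (card (_ // {(a, b). a \<in> _ \<and> b \<in> _ \<and> ?C a b}))")
proof -
  define A where "A = {2..int d - 1}"
  \<comment> \<open>The representative of \<open>1 - a\<close> in the same range.\<close>
  define s where "s a = int d + 1 - a" for a
  have "\<exists>b. b \<in> A \<and> int d dvd a * b - 1" if "a \<in> A" for a
    using modular_inverse_exists[OF assms(1), of a] that by (fastforce simp: A_def)
  then obtain t where t: "t a \<in> A" "int d dvd a * t a - 1" if "a \<in> A" for a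
    by metis
  have dvd_cong: "int d dvd x \<longleftrightarrow> int d dvd y" if "x = y + int d * u" for x y u :: int
    using that by (simp add: dvd_add_left_iff)
  have dvd_cong_minus: "int d dvd x \<longleftrightarrow> int d dvd y" if "x = - y + int d * u" for x y u :: int
    using dvd_cong[OF that] by simp
  have small: "k = 0" if "int d dvd k" "\<bar>k\<bar> < int d" for k
    using that dvd_imp_le_int[of k "int d"] by auto
  have eq_iff: "int d dvd a - b \<longleftrightarrow> a = b" if "a \<in> A" "b \<in> A" for a b
    using that small[of "a - b"] by (auto simp: A_def)
  have s_in: "s a \<in> A" if "a \<in> A" for a
    using that by (simp add: s_def A_def)
  have s_iff: "b = s c \<longleftrightarrow> s b = c" for b c
    by (auto simp: s_def)
  have t_iff: "b = t a \<longleftrightarrow> int d dvd a * b - 1" if "a \<in> A" "b \<in> A" for a b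
  proof
    assume "int d dvd a * b - 1"
    then have "int d dvd b * (a * t a - 1) - t a * (a * b - 1)"
      using t[OF \<open>a \<in> A\<close>] by (intro dvd_diff[OF dvd_mult dvd_mult]) auto
    also have "b * (a * t a - 1) - t a * (a * b - 1) = t a - b"
      by (simp add: algebra_simps)
    finally show "b = t a" using eq_iff[of "t a" b] t that by simp
  qed (use t that in simp)
  have "odd (int d)" using prime_odd_nat[OF assms(1)] assms(2) by simp
  then obtain k where k: "int d = 2 * k + 1" by (rule oddE)
  have prime: "prime (int d)" using assms(1) by simp
  \<comment> \<open>Since \<open>d = 2 * k + 1\<close>, the residue \<open>k + 1\<close> is
    \<open>1/2\<close>, and \<open>d - 1\<close> is \<open>-1\<close>.\<close>
  interpret anharmonic A s t "k + 1" "int d - 1"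
  proof
    fix a assume a: "a \<in> A"
    show "s (s a) = a" by (simp add: s_def)
    show "t (t a) = a"
      using t_iff[of "t a" a] t[OF a] a by (simp add: mult.commute)
    show "s (t (s a)) = t (s (t a))"
    proof -
      define b c where "b = t (s a)" and "c = t a"
      have bc: "b \<in> A" "c \<in> A" using t s_in a by (auto simp: b_def c_def)
      \<comment> \<open>With \<open>b = 1/(1 - a)\<close> and \<open>c = 1/a\<close> the claim is
        \<open>(1 - c) (1 - b) = 1\<close>. The sum combines the defining relations of
        \<open>b\<close> and \<open>c\<close>; its first term collects the multiples of
        \<open>d\<close> from \<open>s\<close>.\<close>
      have "int d dvd int d * (int d + 2 - b - c - b * c) + c * (s a * b - 1) + b * (a * c - 1)"
        using t[OF s_in[OF a]] t[OF a] unfolding b_def c_def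
        by (intro dvd_add[OF dvd_add[OF dvd_triv_left dvd_mult] dvd_mult]) auto
      also have "\<dots> = s c * s b - 1"
        by (simp add: s_def algebra_simps)
      finally have "s b = t (s c)" using t_iff[of "s c" "s b"] bc s_in by simp
      then show ?thesis by (simp add: b_def c_def)
    qed
    show "s a = a \<longleftrightarrow> a = k + 1" using k by (auto simp: s_def)
    have "t a = a \<longleftrightarrow> int d dvd (a - 1) * (a + 1)"
      using t_iff[OF a a] by (auto simp: algebra_simps)
    also have "\<dots> \<longleftrightarrow> int d dvd a + 1"
      using a small[of "a - 1"] by (auto simp: A_def prime_dvd_mult_iff[OF prime])
    also have "\<dots> \<longleftrightarrow> int d dvd a - (int d - 1)"
      by (rule dvd_cong[of _ _ 1]) simp
    also have "\<dots> \<longleftrightarrow> a = int d - 1"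
      using assms(2) by (intro eq_iff[OF a]) (simp add: A_def)
    finally show "t a = a \<longleftrightarrow> a = int d - 1" .
    fix b assume b: "b \<in> A" "s a = t a" "s b = t b"
    \<comment> \<open>Both \<open>a\<close> and \<open>b\<close> solve \<open>x (1 - x) = 1\<close>,
      and the difference of the two equations factors.\<close>
    have "int d dvd (a * s a - 1) - (b * s b - 1)"
      using t[OF a] t[OF b(1)] b by (metis dvd_diff)
    also have "(a * s a - 1) - (b * s b - 1) = (a - b) * (s a - b)"
      by (simp add: s_def algebra_simps)
    finally show "b = a \<or> b = s a"
      using eq_iff[of a b] eq_iff[of "s a" b] a b(1) s_in
      by (auto simp: prime_dvd_mult_iff[OF prime])
  qed (use k assms(2) t s_in in \<open>auto simp: A_def\<close>)
  have "b \<in> orbit a \<longleftrightarrow> ?C a b" if a: "a \<in> A" and b: "b \<in> A" for a b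
  proof -
    \<comment> \<open>In the cases below, the last explicit argument of \<open>dvd_cong\<close> or
      \<open>dvd_cong_minus\<close> is the multiple of \<open>d\<close> produced by
      \<open>s\<close>, and 0 where \<open>s\<close> does not occur.\<close>
    have "b = a \<longleftrightarrow> int d dvd a - b"
      using eq_iff[OF a b] by auto
    moreover have "b = s a \<longleftrightarrow> int d dvd (a - 1) + b"
      unfolding eq_iff[OF b s_in[OF a], symmetric]
      by (rule dvd_cong[of _ _ "- 1"]) (simp add: s_def)
    moreover have "b = t a \<longleftrightarrow> int d dvd 1 - b * a"
      unfolding t_iff[OF a b]
      by (rule dvd_cong_minus[of _ _ 0]) simp
    moreover have "b = s (t a) \<longleftrightarrow> int d dvd (1 - a) + b * a"
      unfolding s_iff t_iff[OF a s_in[OF b]]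
      by (rule dvd_cong_minus[of _ _ a]) (simp add: s_def algebra_simps)
    moreover have "b = t (s a) \<longleftrightarrow> int d dvd 1 + b * (a - 1)"
      unfolding t_iff[OF s_in[OF a] b]
      by (rule dvd_cong_minus[of _ _ b]) (simp add: s_def algebra_simps)
    moreover have "b = s (t (s a)) \<longleftrightarrow> int d dvd a + b * (1 - a)"
      unfolding s_iff t_iff[OF s_in[OF a] s_in[OF b]]
      by (rule dvd_cong_minus[of _ _ "int d + 2 - a - b"]) (simp add: s_def algebra_simps)
    ultimately show ?thesis
      unfolding orbit_def by auto
  qed
  then have rel: "{(a, b). a \<in> A \<and> b \<in> A \<and> ?C a b} = {(a, b). a \<in> A \<and> b \<in> A \<and> b \<in> orbit a}"
    by auto
  have "int (card A) = int d - 2"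
    using assms(2) by (simp add: A_def)
  moreover obtain j where "j \<le> 1"
    "card A + 3 + 4 * j = 6 * card (A // {(a, b). a \<in> A \<and> b \<in> A \<and> b \<in> orbit a})"
    using card_orbits by blast
  ultimately show ?thesis
    unfolding A_def[symmetric] rel by (intro exI[of _ j]) linarith
qed

theorem theorem5p9:
  fixes e :: "'a::{alg_closed_field, field_char_0}" and d n :: nat
  assumes "prime d" and "d \<ge> 5" and "primitive_root_of_unity d e"
  shows "(int d = 6 * int n - 1 \<longrightarrow> num_nonequivalent_actions d e = n) \<and>
         (int d = 6 * int n + 1 \<longrightarrow> num_nonequivalent_actions d e = n + 1)"
proof -
  have "{(a, b). a \<in> {2..int d - 1} \<and> b \<in> {2..int d - 1} \<and> equivalent_actions d e a b} =
    {(a, b). a \<in> {2..int d - 1} \<and> b \<in> {2..int d - 1} \<and>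
      (int d dvd a - b \<or> int d dvd 1 - b * a \<or> int d dvd (a - 1) + b \<or>
       int d dvd 1 + b * (a - 1) \<or> int d dvd (1 - a) + b * a \<or> int d dvd a + b * (1 - a))}"
    by (intro Collect_cong) (auto simp: equivalent_actions_iff[OF assms(1,3)])
  then obtain k where "k \<le> 1" "int d + 1 + 4 * int k = 6 * int (num_nonequivalent_actions d e)"
    using card_anharmonic_classes[OF assms(1,2)] by (auto simp: num_nonequivalent_actions_def)
  \<comment> \<open>For \<open>d = 6n - 1\<close> the equation becomes \<open>6n + 4k = 6N\<close>,
    so \<open>k = 0\<close>; for \<open>d = 6n + 1\<close> it becomes
    \<open>6n + 2 + 4k = 6N\<close>, so \<open>k = 1\<close>.\<close>
  then show ?thesis by (intro conjI impI; linarith)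
qed

end
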